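(* Let $\mathbb{K}=\mathbb{R}$ or $\mathbb{C}$, let $m$ be a positive integer, $p_{1},p_{m}\in[2,\infty]$, $p_{2}=\cdots=p_{m-1}=\infty$, and $\epsilon>0$. There exists a positive integer $N$ such that, for any choice of positive integers $n_{1},\ldots,n_{m}>N$ with $n_{m}=\max\{n_{1},\ldots,n_{m}\}$ and $n_{1}=\min\{n_{1},\ldots,n_{m}\}$, there exists an $m$-linear form $A\colon\ell_{p_{1}}^{n_{1}}\times\ell_{p_{2}}^{n_{2}}\times\cdots\times\ell_{p_{m-1}}^{n_{m-1}}\times\ell_{p_{m}}^{n_{m}}\to\mathbb{K}$ of the type \[ A(z^{(1)},\ldots,z^{(m)})=\sum_{i_{1}=1}^{n_{1}}\cdots\sum_{i_{m}=1}^{n_{m}}\pm z_{i_{1}}^{(1)}\cdots z_{i_{m}}^{(m)} \] satisfying \[ \Vert A\Vert\leq(1+\epsilon)\,n_{m}^{1/2}\prod_{k=1}^{m}n_{k}^{\frac{1}{2}-\frac{1}{p_{k}}}. \]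
   Context: $\ell_{p}^{n}$ denotes $\mathbb{K}^{n}$ with the $\ell_p$-norm; $1/\infty=0$. "Of the type $\sum\pm\cdots$" means each coefficient of $z_{i_1}^{(1)}\cdots z_{i_m}^{(m)}$ lies in $\{-1,1\}$. The norm of an $m$-linear form is the supremum of $|A(x^{(1)},\ldots,x^{(m)})|$ over $\Vert x^{(k)}\Vert_{p_k}\le1$, $k=1,\ldots,m$. *)

theory Defs
  imports Complex_Main "HOL-Library.Extended_Real" "HOL-Library.FuncSet"
begin

text \<open>Since the dimensions are quantified inside the statement, \<open>\<bbbK>\<^sup>n\<close> is a carrier set: the
  vectors with coordinates \<open>1, \<dots>, n\<close>, extended by \<open>0\<close>.\<close>

definition coord_space :: "nat \<Rightarrow> (nat \<Rightarrow> 'a::real_normed_field) set" where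
  "coord_space n = {x. \<forall>i. i \<notin> {1..n} \<longrightarrow> x i = 0}"

definition lp_norm :: "ereal \<Rightarrow> nat \<Rightarrow> (nat \<Rightarrow> 'a::real_normed_field) \<Rightarrow> real" where
  "lp_norm p n x =
     (if p = \<infinity> then Max ((\<lambda>i. norm (x i)) ` {1..n})
      else (\<Sum>i=1..n. norm (x i) powr real_of_ereal p) powr (1 / real_of_ereal p))"

text \<open>In the following, \<open>n k\<close> and \<open>p k\<close> are the dimension and the exponent of the \<open>k\<close>-th factor,
  and \<open>z k i\<close> is the \<open>i\<close>-th coordinate of the \<open>k\<close>-th vector of a tuple \<open>z\<close>.\<close>

definition tuples :: "nat \<Rightarrow> (nat \<Rightarrow> nat) \<Rightarrow> (nat \<Rightarrow> nat \<Rightarrow> 'a::real_normed_field) set" where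
  "tuples m n = (\<Pi>\<^sub>E k\<in>{1..m}. coord_space (n k))"

definition multilinear_form ::
    "nat \<Rightarrow> (nat \<Rightarrow> nat) \<Rightarrow> ((nat \<Rightarrow> nat \<Rightarrow> 'a::real_normed_field) \<Rightarrow> 'a) \<Rightarrow> bool" where
  "multilinear_form m n A \<longleftrightarrow>
     (\<forall>z\<in>tuples m n. \<forall>k\<in>{1..m}. \<forall>x\<in>coord_space (n k). \<forall>y\<in>coord_space (n k). \<forall>a.
        A (z(k := \<lambda>i. x i + y i)) = A (z(k := x)) + A (z(k := y)) \<and>
        A (z(k := \<lambda>i. a * x i)) = a * A (z(k := x)))"

definition sign_type ::
    "nat \<Rightarrow> (nat \<Rightarrow> nat) \<Rightarrow> ((nat \<Rightarrow> nat \<Rightarrow> 'a::real_normed_field) \<Rightarrow> 'a) \<Rightarrow> bool" where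
  "sign_type m n A \<longleftrightarrow>
     (\<exists>c :: (nat \<Rightarrow> nat) \<Rightarrow> 'a.
        (\<forall>i \<in> (\<Pi>\<^sub>E k\<in>{1..m}. {1..n k}). c i \<in> {-1, 1}) \<and>
        (\<forall>z\<in>tuples m n. A z = (\<Sum>i \<in> (\<Pi>\<^sub>E k\<in>{1..m}. {1..n k}). c i * (\<Prod>k=1..m. z k (i k)))))"

text \<open>The supremum is taken in \<^typ>\<open>ereal\<close>, so that it is meaningful without a boundedness proof.\<close>

definition form_norm ::
    "nat \<Rightarrow> (nat \<Rightarrow> ereal) \<Rightarrow> (nat \<Rightarrow> nat) \<Rightarrow> ((nat \<Rightarrow> nat \<Rightarrow> 'a::real_normed_field) \<Rightarrow> 'a) \<Rightarrow> ereal" where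
  "form_norm m p n A =
     (SUP z \<in> {z \<in> tuples m n. \<forall>k\<in>{1..m}. lp_norm (p k) (n k) (z k) \<le> 1}. ereal (norm (A z)))"

end

theory Submission
  imports Defs "HOL-Analysis.Kronecker_Approximation_Theorem"
begin

text \<open>A Hadamard matrix of order \<open>h\<close> is \<open>\<surd>h\<close> times an isometry. Since \<open>log\<^sub>2 12\<close> is irrational, the orders
  \<open>2\<^sup>a 12\<^sup>b\<close> are asymptotically dense on a multiplicative scale, so cutting down a Hadamard matrix yields for
  all large \<open>L\<close> and all \<open>n \<le> L\<close> an \<open>n \<times> L\<close> sign matrix of \<open>\<ell>\<^sub>2\<close> operator norm at most \<open>(1 + \<delta>) \<surd>L\<close>. For
  \<open>n\<^sub>1 \<le> n\<^sub>2 \<le> \<dots> \<le> n\<^sub>m\<close> the form \<open>z\<^sub>1 H D(z\<^sub>2) H D(z\<^sub>3) \<dots> H z\<^sub>m\<close>, with \<open>D(z)\<close> the diagonal matrix of \<open>z\<close>,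
  has signs as coefficients and is bounded by \<open>(1 + \<delta>)\<^sup>m \<surd>(n\<^sub>2 \<dots> n\<^sub>m)\<close> times the \<open>\<ell>\<^sub>2\<close> norms of
  \<open>z\<^sub>1\<close> and \<open>z\<^sub>m\<close>. The inner factors all carry the same norm, so they may be ordered by dimension, and the
  \<open>\<ell>\<^sub>2\<close> norms of the outer ones are compared with their \<open>\<ell>\<^sub>p\<close> norms.\<close>

subsection \<open>Hadamard matrices\<close>

text \<open>Indices start at 0, which suits \<open>div\<close> and \<open>mod\<close> in Kronecker
  products. Entries are signs at all indices, so they stay signs under any reindexing.\<close>

definition hadamard :: "nat \<Rightarrow> (nat \<Rightarrow> nat \<Rightarrow> real) \<Rightarrow> bool" where
  "hadamard h H \<longleftrightarrow> (\<forall>i j. H i j \<in> {-1, 1}) \<and>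
     (\<forall>i<h. \<forall>j<h. (\<Sum>k<h. H i k * H j k) = (if i = j then real h else 0))"

lemma hadamard_1: "hadamard 1 (\<lambda>i j. 1)"
  by (auto simp: hadamard_def)

lemma hadamard_2: "hadamard 2 (\<lambda>i j. if i = 1 \<and> j = 1 then -1 else 1)"
  by (auto simp: hadamard_def numeral_2_eq_2 less_Suc_eq)

lemma sum_lessThan_mult:
  fixes f :: "nat \<Rightarrow> 'a::comm_monoid_add"
  shows "(\<Sum>k<a * b. f k) = (\<Sum>x<a. \<Sum>y<b. f (x * b + y))"
proof -
  have "(\<Sum>k<a * b. f k) = (\<Sum>x<a. sum f {x * b..<x * b + b})"
    by (simp add: sum.nat_group)
  also have "\<dots> = (\<Sum>x<a. \<Sum>y<b. f (x * b + y))"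
  proof (rule sum.cong[OF refl])
    fix x
    show "sum f {x * b..<x * b + b} = (\<Sum>y<b. f (x * b + y))"
      using sum.shift_bounds_nat_ivl[of f 0 "x * b" b] by (simp add: lessThan_atLeast0 add.commute)
  qed
  finally show ?thesis .
qed

text \<open>This is the Kronecker product: the inner product of two of its rows is the product of
  the inner products of the corresponding rows of the factors.\<close>

lemma hadamard_mult:
  assumes "hadamard a F" and "hadamard b G"
  shows "hadamard (a * b) (\<lambda>i j. F (i div b) (j div b) * G (i mod b) (j mod b))"
  unfolding hadamard_def
proof (intro conjI allI impI)
  fix i j
  have "F (i div b) (j div b) \<in> {-1, 1}" "G (i mod b) (j mod b) \<in> {-1, 1}"
    using assms unfolding hadamard_def by blast+
  then show "F (i div b) (j div b) * G (i mod b) (j mod b) \<in> {-1, 1}"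
    by auto
next
  fix i j assume ij: "i < a * b" "j < a * b"
  then have b: "b > 0"
    by (cases b) auto
  have lt: "i div b < a" "j div b < a" "i mod b < b" "j mod b < b"
    using ij b by (auto simp: less_mult_imp_div_less)
  have "(\<Sum>k<a * b. F (i div b) (k div b) * G (i mod b) (k mod b)
            * (F (j div b) (k div b) * G (j mod b) (k mod b)))
      = (\<Sum>x<a. \<Sum>y<b. (F (i div b) x * F (j div b) x) * (G (i mod b) y * G (j mod b) y))"
    unfolding sum_lessThan_mult using b by (intro sum.cong) auto
  also have "\<dots> = (\<Sum>x<a. F (i div b) x * F (j div b) x) * (\<Sum>y<b. G (i mod b) y * G (j mod b) y)"
    by (simp add: sum_product)
  also have "\<dots> = (if i div b = j div b then real a else 0) * (if i mod b = j mod b then real b else 0)"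
    using assms lt by (simp add: hadamard_def)
  also have "\<dots> = (if i = j then real (a * b) else 0)"
  proof (cases "i = j")
    case False
    then have "i div b \<noteq> j div b \<or> i mod b \<noteq> j mod b"
      by (metis div_mult_mod_eq)
    then show ?thesis
      using False by auto
  qed simp
  finally show "(\<Sum>k<a * b. F (i div b) (k div b) * G (i mod b) (k mod b)
            * (F (j div b) (k div b) * G (j mod b) (k mod b)))
      = (if i = j then real (a * b) else 0)" .
qed

lemma hadamard_power:
  assumes "hadamard h H"
  shows "\<exists>G. hadamard (h ^ k) G"
proof (induction k)
  case 0
  then show ?case
    using hadamard_1 by auto
next
  case (Suc k)
  then show ?case
    using hadamard_mult[OF assms] unfolding power_Suc by blast
qed

text \<open>Paley's matrix; 1, 3, 4, 5, 9 are the nonzero squares modulo 11.\<close>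

definition paley_12 :: "nat \<Rightarrow> nat \<Rightarrow> int" where
  "paley_12 i j = (if i = 0 \<or> j = 0 \<or> (j + 11 - i) mod 11 \<in> {1, 3, 4, 5, 9} then 1 else -1)"

text \<open>All pairs of rows are checked by evaluation, in \<open>int\<close> and over lists to be
  executable. For \<open>i < 12\<close> the difference \<open>j + 11 - i\<close> is not truncated,
  so it represents \<open>j - i\<close> modulo 11.\<close>

lemma paley_12_orthogonal:
  assumes "i < 12" and "j < 12"
  shows "(\<Sum>k<12. paley_12 i k * paley_12 j k) = (if i = j then 12 else 0)"
proof -
  have "list_all (\<lambda>i. list_all (\<lambda>j. (\<Sum>k\<leftarrow>[0..<12]. paley_12 i k * paley_12 j k)
      = (if i = j then 12 else 0)) [0..<12]) [0..<12]"
    by code_simp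
  then show ?thesis
    using assms by (auto simp: list_all_iff interv_sum_list_conv_sum_set_nat lessThan_atLeast0)
qed


lemma hadamard_12: "hadamard 12 (\<lambda>i j. real_of_int (paley_12 i j))"
  unfolding hadamard_def
proof (intro conjI allI impI)
  fix i j :: nat assume "i < 12" "j < 12"
  then have "(\<Sum>k<12. paley_12 i k * paley_12 j k) = (if i = j then 12 else 0)"
    by (rule paley_12_orthogonal)
  then have "real_of_int (\<Sum>k<12. paley_12 i k * paley_12 j k) = real_of_int (if i = j then 12 else 0)"
    by (rule arg_cong)
  then show "(\<Sum>k<12. real_of_int (paley_12 i k) * real_of_int (paley_12 j k)) = (if i = j then real 12 else 0)"
    by (simp split: if_splits)
qed (auto simp: paley_12_def)

lemma hadamard_2_12: "\<exists>H. hadamard (2 ^ a * 12 ^ b) H"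
  using hadamard_power[OF hadamard_2, of a] hadamard_power[OF hadamard_12, of b] hadamard_mult
  by blast

section \<open>Density of the orders \<open>2 ^ a * 12 ^ b\<close>\<close>

lemma log_2_12_irrational: "log 2 12 \<notin> \<rat>"
proof
  assume "log 2 12 \<in> \<rat>"
  moreover have "log 2 12 > (0::real)"
    by simp
  ultimately obtain p q :: nat where q: "q \<noteq> 0" and pq: "\<bar>log 2 12\<bar> = real p / real q"
    using Rats_abs_nat_div_natE by metis
  have "real q * log 2 12 = real p"
    using q pq \<open>log 2 12 > 0\<close> by (simp add: field_simps)
  then have "(2::real) powr (real q * log 2 12) = 2 powr real p"
    by simp
  then have "(12::real) ^ q = 2 ^ p"
    by (simp add: powr_realpow powr_powr[symmetric] mult.commute[of "real q"])
  then have "real (12 ^ q) = real (2 ^ p)"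
    by simp
  then have eq: "(12::nat) ^ q = 2 ^ p"
    using of_nat_eq_iff by blast
  \<comment> \<open>The prime 3 divides \<open>12 ^ q\<close>, as \<open>q\<close> is nonzero, but
    no power of 2.\<close>
  have "(3::nat) dvd 12"
    by simp
  also have "(12::nat) dvd 12 ^ q"
    using q by (simp add: dvd_power)
  finally have "(3::nat) dvd 2 ^ p"
    by (simp add: eq)
  moreover have "coprime (3::nat) (2 ^ p)"
    by simp
  ultimately show False
    using coprime_common_divisor_nat[of 3 "2 ^ p" 3] by simp
qed

text \<open>By Kronecker's theorem some multiple of \<open>log 2 12\<close> has a small positive
  fractional part; \<open>a\<close> is the integer part of that multiple.\<close>

lemma ratio_near_1:
  fixes \<delta> :: real
  assumes "\<delta> > 0"
  obtains a b :: nat where "1 < 12 ^ b / (2::real) ^ a" and "12 ^ b / (2::real) ^ a < 1 + \<delta>"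
proof -
  \<comment> \<open>The cap 1 keeps the target \<open>\<eta> / 2\<close> in the unit interval. An
    error below \<open>\<eta> / 2\<close> puts the fractional part strictly between 0 and
    \<open>\<eta>\<close>.\<close>
  define \<eta> where "\<eta> = min 1 (log 2 (1 + \<delta>))"
  have \<eta>: "0 < \<eta>" "\<eta> \<le> 1" "\<eta> \<le> log 2 (1 + \<delta>)"
    using assms by (auto simp: \<eta>_def)
  obtain b where "b > 0" and b: "\<bar>frac (real b * log 2 12) - \<eta> / 2\<bar> < \<eta> / 2"
    by (rule Kronecker_approx_1_explicit[OF log_2_12_irrational, of "\<eta> / 2" "\<eta> / 2"]) (use \<eta> in auto)
  define a where "a = nat \<lfloor>real b * log 2 12\<rfloor>"
  define f where "f = frac (real b * log 2 12)"
  have f: "0 < f" "f < log 2 (1 + \<delta>)"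
    using b \<eta> unfolding f_def by linarith+
  have "real b * log 2 12 \<ge> 0"
    by simp
  then have "real b * log 2 12 - real a = f"
    by (simp add: a_def f_def frac_def)
  moreover have "12 ^ b / (2::real) ^ a = 2 powr (real b * log 2 12 - real a)"
    by (simp add: powr_diff powr_realpow powr_powr[symmetric] mult.commute[of "real b"])
  ultimately have eq: "12 ^ b / (2::real) ^ a = 2 powr f"
    by simp
  have "2 powr f < 2 powr (log 2 (1 + \<delta>))"
    using f by (intro powr_less_mono) auto
  then have "2 powr f < 1 + \<delta>"
    using assms by simp
  moreover have "1 < 2 powr f"
    using f by simp
  ultimately show thesis
    using that eq by metis
qed

text \<open>If \<open>r = 12\<^sup>b / 2\<^sup>a\<close> is slightly larger than 1, then the numbers \<open>2\<^sup>t r\<^sup>k\<close> climb from \<open>2\<^sup>t\<close> past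
  \<open>2\<^sup>t\<^sup>+\<^sup>1\<close> in steps of ratio \<open>r\<close>, and they are of the form \<open>2\<^sup>c 12\<^sup>d\<close> as long as \<open>a k \<le> t\<close>.\<close>

lemma hadamard_orders_dense:
  fixes \<delta> :: real
  assumes "\<delta> > 0"
  shows "\<exists>N. \<forall>L>N. \<exists>h\<ge>L. real h \<le> (1 + \<delta>) * real L \<and> (\<exists>H. hadamard h H)"
proof -
  obtain a b where r1: "1 < 12 ^ b / (2::real) ^ a" and r2: "12 ^ b / (2::real) ^ a < 1 + \<delta>"
    using ratio_near_1[OF assms] .
  define r where "r = 12 ^ b / (2::real) ^ a"
  have r: "1 < r" "r < 1 + \<delta>"
    using r1 r2 by (auto simp: r_def)
  obtain K where K: "2 < r ^ K"
    using real_arch_pow[OF r(1)] by blast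
  show ?thesis
  proof (rule exI[of _ "2 ^ (a * K)"], intro allI impI)
    fix L :: nat assume L: "L > 2 ^ (a * K)"
    then have "L > 0"
      by simp
    obtain t where t: "2 ^ t \<le> L" "L < 2 ^ (t + 1)"
      using ex_power_ivl1[of 2 L] \<open>L > 0\<close> by auto
    \<comment> \<open>The threshold \<open>2 ^ (a * K)\<close> for \<open>L\<close> is chosen for
      this: with \<open>k \<le> K\<close> it gives \<open>a * k \<le> t\<close>.\<close>
    have "a * K < t + 1"
      using L t(2) by (metis less_trans one_less_numeral_iff power_less_imp_less_exp semiring_norm(76))
    \<comment> \<open>The first step that reaches \<open>L\<close>; the step before is still below
      \<open>L\<close>, so the overshoot is at most the factor \<open>r\<close>.\<close>
    define k where "k = (LEAST k. real L \<le> 2 ^ t * r ^ k)"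
    have "real L \<le> 2 ^ t * r ^ K"
    proof -
      have "real L \<le> real (2 ^ (t + 1))"
        using t(2) by (simp only: of_nat_le_iff)
      also have "\<dots> = 2 ^ t * 2"
        by simp
      also have "\<dots> \<le> 2 ^ t * r ^ K"
        using K by simp
      finally show ?thesis .
    qed
    then have kL: "real L \<le> 2 ^ t * r ^ k" and kK: "k \<le> K"
      unfolding k_def by (auto intro: LeastI Least_le)
    have up: "2 ^ t * r ^ k \<le> r * real L"
    proof (cases k)
      case 0
      have "real (2 ^ t) \<le> real L"
        using t(1) by (simp only: of_nat_le_iff)
      also have "real L \<le> r * real L"
        using mult_right_mono[of 1 r "real L"] r by simp
      finally show ?thesis
        using 0 by simp
    next
      case (Suc l)
      then have "\<not> real L \<le> 2 ^ t * r ^ l"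
        using not_less_Least[of l] unfolding k_def by (metis lessI)
      then show ?thesis
        using r Suc by simp
    qed
    have "a * k \<le> t"
      using \<open>a * K < t + 1\<close> mult_le_mono2[OF kK, of a] by linarith
    then have h: "2 ^ t * r ^ k = real (2 ^ (t - a * k) * 12 ^ (b * k))"
      by (simp add: r_def power_divide power_mult[symmetric] power_diff real_of_nat_div le_imp_power_dvd)
    show "\<exists>h\<ge>L. real h \<le> (1 + \<delta>) * real L \<and> (\<exists>H. hadamard h H)"
    proof (intro exI[of _ "2 ^ (t - a * k) * 12 ^ (b * k)"] conjI hadamard_2_12)
      show "L \<le> 2 ^ (t - a * k) * 12 ^ (b * k)"
        using kL unfolding h of_nat_le_iff .
      have "r * real L \<le> (1 + \<delta>) * real L"
        using r by (intro mult_right_mono) auto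
      then show "real (2 ^ (t - a * k) * 12 ^ (b * k)) \<le> (1 + \<delta>) * real L"
        using up unfolding h by linarith
    qed
  qed
qed

section \<open>Operator norms of Hadamard matrices and their submatrices\<close>

lemma hadamard_isometry:
  fixes w :: "nat \<Rightarrow> 'a::real_inner"
  assumes "hadamard h H"
  shows "(\<Sum>j<h. (norm (\<Sum>i<h. H i j *\<^sub>R w i))\<^sup>2) = real h * (\<Sum>i<h. (norm (w i))\<^sup>2)"
proof -
  have "(\<Sum>j<h. (norm (\<Sum>i<h. H i j *\<^sub>R w i))\<^sup>2)
      = (\<Sum>j<h. \<Sum>i<h. \<Sum>l<h. (H i j * H l j) * (w i \<bullet> w l))"
    unfolding power2_norm_eq_inner inner_sum_left inner_sum_right
    by (intro sum.cong refl) (simp add: inner_commute)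
  \<comment> \<open>Summing over \<open>j\<close> first produces inner products of rows, and
    orthogonality leaves only the diagonal.\<close>
  also have "\<dots> = (\<Sum>i<h. \<Sum>l<h. (\<Sum>j<h. H i j * H l j) * (w i \<bullet> w l))"
    unfolding sum_distrib_right by (rule trans[OF sum.swap sum.cong[OF refl sum.swap]])
  also have "\<dots> = (\<Sum>i<h. \<Sum>l<h. (if i = l then real h else 0) * (w i \<bullet> w l))"
    using assms by (intro sum.cong refl) (auto simp: hadamard_def)
  also have "\<dots> = (\<Sum>i<h. \<Sum>l<h. if i = l then real h * (w i \<bullet> w l) else 0)"
    by (intro sum.cong refl) auto
  also have "\<dots> = real h * (\<Sum>i<h. (norm (w i))\<^sup>2)"
    by (simp add: sum_distrib_left power2_norm_eq_inner)
  finally show ?thesis .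
qed

text \<open>Missing rows amount to padding \<open>w\<close> with zeros, and missing columns only
  drop nonnegative terms.\<close>

lemma hadamard_submatrix_bound:
  fixes H :: "nat \<Rightarrow> nat \<Rightarrow> real" and w :: "nat \<Rightarrow> 'a::real_inner"
  assumes "hadamard h H" and "n \<le> h" and "L \<le> h"
  shows "(\<Sum>j=1..L. (norm (\<Sum>i=1..n. H (i - 1) (j - 1) *\<^sub>R w i))\<^sup>2)
           \<le> real h * (\<Sum>i=1..n. (norm (w i))\<^sup>2)"
proof -
  \<comment> \<open>Zero padding together with the shift from indices starting at 1 to indices
    starting at 0.\<close>
  define v where "v i = (if i < n then w (Suc i) else 0)" for i
  have v: "(\<Sum>i<h. f i (v i)) = (\<Sum>i=1..n. f (i - 1) (w i))"
    if "\<And>i. f i 0 = 0" for f :: "nat \<Rightarrow> 'a \<Rightarrow> 'b::comm_monoid_add"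
  proof -
    have "(\<Sum>i<h. f i (v i)) = (\<Sum>i<n. f i (v i))"
      using assms(2) that by (intro sum.mono_neutral_right) (auto simp: v_def)
    also have "\<dots> = (\<Sum>i=1..n. f (i - 1) (w i))"
      by (simp add: sum.atLeast1_atMost_eq v_def)
    finally show ?thesis .
  qed
  have "(\<Sum>j=1..L. (norm (\<Sum>i=1..n. H (i - 1) (j - 1) *\<^sub>R w i))\<^sup>2)
      = (\<Sum>j<L. (norm (\<Sum>i<h. H i j *\<^sub>R v i))\<^sup>2)"
    using v[of "\<lambda>i x. H i _ *\<^sub>R x"] by (simp add: sum.atLeast1_atMost_eq)
  also have "\<dots> \<le> (\<Sum>j<h. (norm (\<Sum>i<h. H i j *\<^sub>R v i))\<^sup>2)"
    using assms(3) by (intro sum_mono2) auto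
  also have "\<dots> = real h * (\<Sum>i=1..n. (norm (w i))\<^sup>2)"
    using v[of "\<lambda>i x. (norm x)\<^sup>2"] by (simp add: hadamard_isometry[OF assms(1)])
  finally show ?thesis .
qed

subsection \<open>Chains of sign matrices\<close>

lemma sum_PiE_insert:
  assumes "x \<notin> S"
  shows "(\<Sum>i\<in>PiE (insert x S) T. F i) = (\<Sum>a\<in>T x. \<Sum>g\<in>PiE S T. F (g(x := a)))"
proof -
  have "(\<Sum>i\<in>PiE (insert x S) T. F i) = (\<Sum>(a, g)\<in>T x \<times> PiE S T. F (g(x := a)))"
    unfolding PiE_insert_eq
    by (subst sum.reindex[OF inj_combinator[OF assms]]) (simp add: case_prod_unfold)
  then show ?thesis
    by (simp add: sum.cartesian_product)
qed

text \<open>The form with coefficients \<open>c\<close> in the slots \<open>S\<close> only, so that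
  a form can be built slot by slot. Real coefficients serve both scalar fields.\<close>

definition contraction ::
    "(nat \<Rightarrow> nat) \<Rightarrow> nat set \<Rightarrow> ((nat \<Rightarrow> nat) \<Rightarrow> real) \<Rightarrow> (nat \<Rightarrow> nat \<Rightarrow> 'a::real_normed_field) \<Rightarrow> 'a" where
  "contraction n S c z = (\<Sum>i\<in>(\<Pi>\<^sub>E k\<in>S. {1..n k}). of_real (c i) * (\<Prod>k\<in>S. z k (i k)))"

lemma contraction_insert:
  assumes "finite S" and "x \<notin> S"
  shows "contraction n (insert x S) c z
       = (\<Sum>a=1..n x. z x a * contraction n S (\<lambda>i. c (i(x := a))) z)"
proof -
  have "(\<Prod>k\<in>S. z k ((g(x := a)) k)) = (\<Prod>k\<in>S. z k (g k))" for g a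
    using assms by (intro prod.cong) auto
  then show ?thesis
    unfolding contraction_def sum_PiE_insert[OF assms(2)]
    using assms by (simp add: sum_distrib_left mult.left_commute)
qed

text \<open>One link of the chain: the old contraction, with output index \<open>a\<close>, is
  multiplied by the diagonal matrix of \<open>z x\<close> and then paired with a column
  \<open>d\<close> of the next matrix.\<close>

lemma contraction_insert_product:
  assumes "finite S" and "x \<notin> S"
  shows "contraction n (insert x S) (\<lambda>i. c (restrict i S) (i x) * d (i x)) z
       = (\<Sum>a=1..n x. d a *\<^sub>R (z x a * contraction n S (\<lambda>i. c i a) z))"
  unfolding contraction_insert[OF assms]
proof (intro sum.cong refl)
  fix a
  have "contraction n S (\<lambda>i. c (restrict (i(x := a)) S) a * d a) z
      = of_real (d a) * contraction n S (\<lambda>i. c i a) z"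
    unfolding contraction_def sum_distrib_left
  proof (intro sum.cong refl)
    fix i assume "i \<in> (\<Pi>\<^sub>E k\<in>S. {1..n k})"
    \<comment> \<open>Outside \<open>S\<close> both sides are \<open>undefined\<close>, since
      \<open>i\<close> is extensional.\<close>
    then have "restrict (i(x := a)) S = i"
      using assms(2) by (auto simp: restrict_def fun_eq_iff PiE_def extensional_def)
    then show "of_real (c (restrict (i(x := a)) S) a * d a) * (\<Prod>k\<in>S. z k (i k))
        = of_real (d a) * (of_real (c i a) * (\<Prod>k\<in>S. z k (i k)))"
      by simp
  qed
  then show "z x a * contraction n S (\<lambda>i. c (restrict (i(x := a)) S) ((i(x := a)) x) * d ((i(x := a)) x)) z
      = d a *\<^sub>R (z x a * contraction n S (\<lambda>i. c i a) z)"
    by (simp add: scaleR_conv_of_real)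
qed

text \<open>The squared operator norm is bounded, so \<open>C\<close> stands for the square of a
  factor \<open>1 + \<delta>\<close>. The type argument fixes the scalars over which
  \<open>w\<close> ranges.\<close>

definition sign_bounded :: "real \<Rightarrow> nat \<Rightarrow> 'a::real_normed_vector itself \<Rightarrow> bool" where
  "sign_bounded C N _ \<longleftrightarrow> (\<forall>n L. N < L \<and> n \<le> L \<longrightarrow>
     (\<exists>H::nat \<Rightarrow> nat \<Rightarrow> real. (\<forall>i j. H i j \<in> {-1, 1}) \<and>
       (\<forall>w::nat \<Rightarrow> 'a. (\<Sum>j=1..L. (norm (\<Sum>i=1..n. H i j *\<^sub>R w i))\<^sup>2)
          \<le> C * real L * (\<Sum>i=1..n. (norm (w i))\<^sup>2))))"

text \<open>The matrix consists of the first \<open>n\<close> rows and \<open>L\<close> columns of a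
  Hadamard matrix whose order lies between \<open>L\<close> and \<open>C * L\<close>.\<close>

lemma ex_sign_bounded:
  assumes "C > 1"
  shows "\<exists>N. sign_bounded C N TYPE('a::real_inner)"
proof -
  obtain N where N: "\<forall>L>N. \<exists>h\<ge>L. real h \<le> (1 + (C - 1)) * real L \<and> (\<exists>H. hadamard h H)"
    using hadamard_orders_dense[of "C - 1"] assms by auto
  have "sign_bounded C N TYPE('a)"
    unfolding sign_bounded_def
  proof (intro allI impI)
    fix n L assume L: "N < L \<and> n \<le> L"
    then obtain h H where h: "h \<ge> L" "real h \<le> C * real L" and H: "hadamard h H"
      using N by auto
    show "\<exists>H::nat \<Rightarrow> nat \<Rightarrow> real. (\<forall>i j. H i j \<in> {-1, 1}) \<and>
       (\<forall>w::nat \<Rightarrow> 'a. (\<Sum>j=1..L. (norm (\<Sum>i=1..n. H i j *\<^sub>R w i))\<^sup>2)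
          \<le> C * real L * (\<Sum>i=1..n. (norm (w i))\<^sup>2))"
    proof (intro exI[of _ "\<lambda>i j. H (i - 1) (j - 1)"] conjI allI)
      show "H (i - 1) (j - 1) \<in> {-1, 1}" for i j
        using H unfolding hadamard_def by blast
      fix w :: "nat \<Rightarrow> 'a"
      have "(\<Sum>j=1..L. (norm (\<Sum>i=1..n. H (i - 1) (j - 1) *\<^sub>R w i))\<^sup>2)
          \<le> real h * (\<Sum>i=1..n. (norm (w i))\<^sup>2)"
        by (rule hadamard_submatrix_bound[OF H]) (use L h(1) in auto)
      also have "\<dots> \<le> C * real L * (\<Sum>i=1..n. (norm (w i))\<^sup>2)"
        using h(2) by (intro mult_right_mono sum_nonneg) auto
      finally show "(\<Sum>j=1..L. (norm (\<Sum>i=1..n. H (i - 1) (j - 1) *\<^sub>R w i))\<^sup>2)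
          \<le> C * real L * (\<Sum>i=1..n. (norm (w i))\<^sup>2)" .
    qed
  qed
  then show ?thesis ..
qed

text \<open>The vector \<open>v\<^sub>j = contraction \<dots> (\<lambda>i. c i j) z\<close> is \<open>z\<^sub>r H D\<^sub>1 H D\<^sub>2 \<dots> H\<close>. Inserting the indices of \<open>S\<close>
  in increasing order of \<open>n k\<close> makes every matrix at least as wide as it is high, so it costs only a factor
  \<open>C\<close> times its width.\<close>

lemma chain_bound:
  fixes n :: "nat \<Rightarrow> nat" and C :: real
  assumes good: "sign_bounded C N TYPE('a::{real_normed_field, real_inner})" and C: "C \<ge> 0"
    and "finite S" and "r \<notin> S" and "N < n r" and "\<forall>k\<in>S. n r \<le> n k"
  shows "\<forall>L. (\<forall>k\<in>insert r S. n k \<le> L) \<longrightarrow>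
     (\<exists>c :: (nat \<Rightarrow> nat) \<Rightarrow> nat \<Rightarrow> real. (\<forall>i j. c i j \<in> {-1, 1}) \<and>
       (\<forall>z :: nat \<Rightarrow> nat \<Rightarrow> 'a. (\<forall>k\<in>S. \<forall>i\<in>{1..n k}. norm (z k i) \<le> 1) \<longrightarrow>
          (\<Sum>j=1..L. (norm (contraction n (insert r S) (\<lambda>i. c i j) z))\<^sup>2)
            \<le> C ^ Suc (card S) * real L * (\<Prod>k\<in>S. real (n k)) * (\<Sum>i=1..n r. (norm (z r i))\<^sup>2)))"
  using assms(3-)
proof (induction S rule: finite_ranking_induct[where f = n])
  case empty
  show ?case
  proof (intro allI impI)
    fix L assume L: "\<forall>k\<in>insert r {}. n k \<le> L"
    obtain H :: "nat \<Rightarrow> nat \<Rightarrow> real" where H: "\<And>i j. H i j \<in> {-1, 1}"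
      and bd: "\<And>w::nat \<Rightarrow> 'a. (\<Sum>j=1..L. (norm (\<Sum>i=1..n r. H i j *\<^sub>R w i))\<^sup>2)
          \<le> C * real L * (\<Sum>i=1..n r. (norm (w i))\<^sup>2)"
      using good[unfolded sign_bounded_def, rule_format, of L "n r"] L empty by auto
    have "contraction n {r} (\<lambda>i. H (i r) j) z = (\<Sum>i=1..n r. H i j *\<^sub>R z r i)"
      for z :: "nat \<Rightarrow> nat \<Rightarrow> 'a" and j
      by (subst contraction_insert) (auto simp: contraction_def scaleR_conv_of_real mult.commute)
    then show "\<exists>c :: (nat \<Rightarrow> nat) \<Rightarrow> nat \<Rightarrow> real. (\<forall>i j. c i j \<in> {-1, 1}) \<and>
       (\<forall>z :: nat \<Rightarrow> nat \<Rightarrow> 'a. (\<forall>k\<in>{}. \<forall>i\<in>{1..n k}. norm (z k i) \<le> 1) \<longrightarrow>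
          (\<Sum>j=1..L. (norm (contraction n (insert r {}) (\<lambda>i. c i j) z))\<^sup>2)
            \<le> C ^ Suc (card {}) * real L * (\<Prod>k\<in>{}. real (n k)) * (\<Sum>i=1..n r. (norm (z r i))\<^sup>2))"
      using H bd by (intro exI[of _ "\<lambda>i j. H (i r) j"]) auto
  qed
next
  case (insert x S)
  show ?case
  \<comment> \<open>The induction rule supplies an \<open>x\<close> with \<open>n x\<close> maximal,
    but possibly already in \<open>S\<close>.\<close>
  proof (cases "x \<in> S")
    case True
    then show ?thesis
      using insert by (simp add: insert_absorb)
  next
    case False
    have xr: "x \<notin> insert r S"
      using False insert.prems by auto
    show ?thesis
    proof (intro allI impI)
      fix L assume L: "\<forall>k\<in>insert r (insert x S). n k \<le> L"
      then have "N < L" "n x \<le> L"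
        using insert.prems by (auto intro: less_le_trans)
      then obtain H :: "nat \<Rightarrow> nat \<Rightarrow> real" where H: "\<And>i j. H i j \<in> {-1, 1}"
        and bd: "\<And>w::nat \<Rightarrow> 'a. (\<Sum>j=1..L. (norm (\<Sum>i=1..n x. H i j *\<^sub>R w i))\<^sup>2)
            \<le> C * real L * (\<Sum>i=1..n x. (norm (w i))\<^sup>2)"
        using good[unfolded sign_bounded_def, rule_format, of L "n x"] by auto
      \<comment> \<open>The induction hypothesis is used with width \<open>n x\<close>: the output
        index of the shorter chain becomes the index of slot \<open>x\<close>.\<close>
      have "\<forall>k\<in>insert r S. n k \<le> n x"
        using insert.hyps insert.prems by auto
      moreover have "r \<notin> S" "\<forall>k\<in>S. n r \<le> n k"
        using insert.prems by auto
      ultimately obtain c :: "(nat \<Rightarrow> nat) \<Rightarrow> nat \<Rightarrow> real" where c: "\<And>i j. c i j \<in> {-1, 1}"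
        and cb: "\<And>z :: nat \<Rightarrow> nat \<Rightarrow> 'a. (\<forall>k\<in>S. \<forall>i\<in>{1..n k}. norm (z k i) \<le> 1) \<Longrightarrow>
          (\<Sum>j=1..n x. (norm (contraction n (insert r S) (\<lambda>i. c i j) z))\<^sup>2)
            \<le> C ^ Suc (card S) * real (n x) * (\<Prod>k\<in>S. real (n k)) * (\<Sum>i=1..n r. (norm (z r i))\<^sup>2)"
        using insert.IH \<open>N < n r\<close> by blast
      \<comment> \<open>The old sign with output index \<open>i x\<close>, times the entry of
        \<open>H\<close> leading from \<open>i x\<close> to the new output index
        \<open>j\<close>.\<close>
      define d where "d i j = c (restrict i (insert r S)) (i x) * H (i x) j" for i j
      show "\<exists>c :: (nat \<Rightarrow> nat) \<Rightarrow> nat \<Rightarrow> real. (\<forall>i j. c i j \<in> {-1, 1}) \<and>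
       (\<forall>z :: nat \<Rightarrow> nat \<Rightarrow> 'a. (\<forall>k\<in>insert x S. \<forall>i\<in>{1..n k}. norm (z k i) \<le> 1) \<longrightarrow>
          (\<Sum>j=1..L. (norm (contraction n (insert r (insert x S)) (\<lambda>i. c i j) z))\<^sup>2)
            \<le> C ^ Suc (card (insert x S)) * real L * (\<Prod>k\<in>insert x S. real (n k))
                * (\<Sum>i=1..n r. (norm (z r i))\<^sup>2))"
      proof (intro exI[of _ d] conjI allI impI)
        show "d i j \<in> {-1, 1}" for i j
          using c[of "restrict i (insert r S)" "i x"] H[of "i x" j] by (auto simp: d_def)
        fix z :: "nat \<Rightarrow> nat \<Rightarrow> 'a"
        assume z: "\<forall>k\<in>insert x S. \<forall>i\<in>{1..n k}. norm (z k i) \<le> 1"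
        let ?v = "\<lambda>a. contraction n (insert r S) (\<lambda>i. c i a) z"
        have "(\<Sum>j=1..L. (norm (contraction n (insert r (insert x S)) (\<lambda>i. d i j) z))\<^sup>2)
            = (\<Sum>j=1..L. (norm (\<Sum>a=1..n x. H a j *\<^sub>R (z x a * ?v a)))\<^sup>2)"
          unfolding d_def insert_commute[of r x]
          by (intro sum.cong refl arg_cong[where f = "\<lambda>v. (norm v)\<^sup>2"]
              contraction_insert_product[OF _ xr, where d = "\<lambda>a. H a j" for j])
            (use insert.hyps in simp)
        also have "\<dots> \<le> C * real L * (\<Sum>a=1..n x. (norm (z x a * ?v a))\<^sup>2)"
          by (rule bd)
        \<comment> \<open>The diagonal matrix of \<open>z x\<close> is a contraction because its
          entries have norm at most 1.\<close>
        also have "\<dots> \<le> C * real L * (\<Sum>a=1..n x. (norm (?v a))\<^sup>2)"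
        proof (intro mult_left_mono sum_mono power_mono)
          fix a assume "a \<in> {1..n x}"
          then show "norm (z x a * ?v a) \<le> norm (?v a)"
            using z by (simp add: norm_mult mult_left_le_one_le)
        qed (use C in auto)
        also have "\<dots> \<le> C * real L *
            (C ^ Suc (card S) * real (n x) * (\<Prod>k\<in>S. real (n k)) * (\<Sum>i=1..n r. (norm (z r i))\<^sup>2))"
          using C z by (intro mult_left_mono cb) auto
        also have "\<dots> = C ^ Suc (card (insert x S)) * real L * (\<Prod>k\<in>insert x S. real (n k))
                * (\<Sum>i=1..n r. (norm (z r i))\<^sup>2)"
          using insert.hyps False by simp
        finally show "(\<Sum>j=1..L. (norm (contraction n (insert r (insert x S)) (\<lambda>i. d i j) z))\<^sup>2)
            \<le> C ^ Suc (card (insert x S)) * real L * (\<Prod>k\<in>insert x S. real (n k))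
                * (\<Sum>i=1..n r. (norm (z r i))\<^sup>2)" .
      qed
    qed
  qed
qed

subsection \<open>Norm estimates\<close>

lemma norm_sum_mult_le:
  fixes f g :: "nat \<Rightarrow> 'a::real_normed_field"
  shows "(norm (\<Sum>i\<in>I. f i * g i))\<^sup>2 \<le> (\<Sum>i\<in>I. (norm (f i))\<^sup>2) * (\<Sum>i\<in>I. (norm (g i))\<^sup>2)"
proof -
  have "norm (\<Sum>i\<in>I. f i * g i) \<le> (\<Sum>i\<in>I. norm (f i) * norm (g i))"
    by (rule sum_norm_le) (simp add: norm_mult)
  then have "(norm (\<Sum>i\<in>I. f i * g i))\<^sup>2 \<le> (\<Sum>i\<in>I. norm (f i) * norm (g i))\<^sup>2"
    by (rule power_mono) simp
  also have "\<dots> \<le> (\<Sum>i\<in>I. (norm (f i))\<^sup>2) * (\<Sum>i\<in>I. (norm (g i))\<^sup>2)"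
    by (rule Cauchy_Schwarz_ineq_sum)
  finally show ?thesis .
qed

text \<open>Hoelder's inequality against a constant sequence, by summing Young's inequality.\<close>

lemma sum_le_of_sum_powr_le:
  fixes t :: "nat \<Rightarrow> real"
  assumes "P > 1" and n: "n > 0" and t: "\<And>i. t i \<ge> 0" and le: "(\<Sum>i=1..n. t i powr P) \<le> 1"
  shows "(\<Sum>i=1..n. t i) \<le> real n powr (1 - 1 / P)"
proof -
  define Q where "Q = P / (P - 1)"
  have Q: "Q > 1" "1 / P + 1 / Q = 1" "1 - 1 / P = 1 / Q"
    using assms(1) by (auto simp: Q_def field_simps)
  \<comment> \<open>The constant sequence \<open>b\<close> has unit norm for the conjugate exponent
    \<open>Q\<close>, so the right sides of Young's inequality add up to at most
    \<open>1 / P + 1 / Q = 1\<close>.\<close>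
  define b where "b = real n powr (- 1 / Q)"
  have "b > 0"
    using n by (simp add: b_def)
  moreover have "b powr Q = real n powr (- 1)"
    unfolding b_def powr_powr using Q(1) by simp
  ultimately have b: "b > 0" "b powr Q = 1 / real n"
    using n by (auto simp: powr_minus_divide)
  have "(\<Sum>i=1..n. t i) * b = (\<Sum>i=1..n. t i * b)"
    by (rule sum_distrib_right)
  also have "\<dots> \<le> (\<Sum>i=1..n. t i powr P / P + b powr Q / Q)"
    using assms Q b by (intro sum_mono Youngs_inequality) auto
  also have "\<dots> = (\<Sum>i=1..n. t i powr P) / P + 1 / Q"
    using n b by (simp add: sum.distrib sum_divide_distrib)
  also have "\<dots> \<le> 1 / P + 1 / Q"
    using le assms(1) by (intro add_right_mono divide_right_mono) auto
  finally have "(\<Sum>i=1..n. t i) * b \<le> 1"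
    using Q by simp
  then have "(\<Sum>i=1..n. t i) \<le> 1 / b"
    using b by (simp add: field_simps)
  also have "1 / b = real n powr (1 - 1 / P)"
    unfolding Q(3) b_def by (simp add: powr_minus_divide)
  finally show ?thesis .
qed

lemma norm_le_1_if_lp_norm_infinity_le_1:
  assumes "lp_norm \<infinity> n x \<le> 1" and "i \<in> {1..n}"
  shows "norm (x i) \<le> 1"
proof -
  have "norm (x i) \<le> Max ((\<lambda>i. norm (x i)) ` {1..n})"
    using assms(2) by (intro Max_ge) auto
  then show ?thesis
    using assms(1) by (simp add: lp_norm_def)
qed

text \<open>For finite \<open>p\<close> this is Hoelder's inequality for the squares
  \<open>(norm (x i))\<^sup>2\<close> with exponent \<open>p / 2\<close>; for infinite
  \<open>p\<close> each square is at most 1.\<close>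

lemma l2_le_if_lp_norm_le_1:
  fixes x :: "nat \<Rightarrow> 'a::real_normed_field"
  assumes p: "p \<in> {2..\<infinity>}" and n: "n > 0" and le: "lp_norm p n x \<le> 1"
  shows "(\<Sum>i=1..n. (norm (x i))\<^sup>2) \<le> (real n powr (1 / 2 - real_of_ereal (1 / p)))\<^sup>2"
proof -
  have sq: "(real n powr s)\<^sup>2 = real n powr (2 * s)" for s
    by (simp add: power2_eq_square powr_add[symmetric])
  show ?thesis
  proof (cases "p = \<infinity>")
    case True
    have "(\<Sum>i=1..n. (norm (x i))\<^sup>2) \<le> (\<Sum>i=1..n. 1)"
      using norm_le_1_if_lp_norm_infinity_le_1[of n x] le True by (intro sum_mono power_le_one) auto
    also have "\<dots> = (real n powr (1 / 2 - real_of_ereal (1 / p)))\<^sup>2"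
      using True n by (simp add: sq)
    finally show ?thesis .
  next
    case False
    then obtain q where q: "p = ereal q"
      using p by (cases p) auto
    then have q2: "q \<ge> 2"
      using p by simp
    let ?s = "\<Sum>i=1..n. norm (x i) powr q"
    have s0: "?s \<ge> 0"
      by (intro sum_nonneg) auto
    have "?s powr (1 / q) \<le> 1"
      using le False q by (simp add: lp_norm_def)
    then have "(?s powr (1 / q)) powr q \<le> 1 powr q"
      using q2 by (intro powr_mono2) auto
    then have s1: "?s \<le> 1"
      using q2 s0 by (simp add: powr_powr)
    have "(norm (x i))\<^sup>2 powr (q / 2) = norm (x i) powr q" for i
    proof (cases "x i = 0")
      case False
      then have "(norm (x i))\<^sup>2 powr (q / 2) = (norm (x i) powr 2) powr (q / 2)"
        by simp
      then show ?thesis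
        unfolding powr_powr by simp
    qed simp
    then have s2: "(\<Sum>i=1..n. (norm (x i))\<^sup>2 powr (q / 2)) \<le> 1"
      using s1 by simp
    have inv: "real_of_ereal (1 / p) = 1 / q"
      using q q2 by (simp add: one_ereal_def)
    have "(\<Sum>i=1..n. (norm (x i))\<^sup>2) \<le> real n powr (1 - 1 / (q / 2))"
    \<comment> \<open>Here the exponent \<open>q / 2\<close> is 1, outside the range of the Hoelder
      lemma, and the bound is \<open>s2\<close> itself.\<close>
    proof (cases "q = 2")
      case True
      then show ?thesis
        using s2 n by (simp add: powr_one)
    next
      case False
      then show ?thesis
        using q2 n s2 by (intro sum_le_of_sum_powr_le) auto
    qed
    then show ?thesis
      unfolding inv sq by (simp add: algebra_simps)
  qed
qed

section \<open>Contractions as multilinear forms of sign type, and their norm\<close>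

lemma multilinear_form_contraction: "multilinear_form m n (contraction n {1..m} c)"
proof -
  \<comment> \<open>Isolates slot \<open>k\<close> in every term; the remaining factor does not
    depend on \<open>x\<close>.\<close>
  have split: "contraction n {1..m} c (z(k := x))
      = (\<Sum>i\<in>(\<Pi>\<^sub>E k\<in>{1..m}. {1..n k}). x (i k) * (of_real (c i) * (\<Prod>l\<in>{1..m} - {k}. z l (i l))))"
    if "k \<in> {1..m}" for z :: "nat \<Rightarrow> nat \<Rightarrow> 'a" and k x
    unfolding contraction_def
  proof (intro sum.cong refl)
    fix i
    have "(\<Prod>l\<in>{1..m}. (z(k := x)) l (i l)) = x (i k) * (\<Prod>l\<in>{1..m} - {k}. (z(k := x)) l (i l))"
      using that by (subst prod.remove[of _ k]) auto
    also have "(\<Prod>l\<in>{1..m} - {k}. (z(k := x)) l (i l)) = (\<Prod>l\<in>{1..m} - {k}. z l (i l))"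
      by (intro prod.cong) auto
    finally show "of_real (c i) * (\<Prod>l\<in>{1..m}. (z(k := x)) l (i l))
        = x (i k) * (of_real (c i) * (\<Prod>l\<in>{1..m} - {k}. z l (i l)))"
      by (simp add: mult_ac)
  qed
  show ?thesis
    unfolding multilinear_form_def
  proof (intro ballI allI)
    fix z :: "nat \<Rightarrow> nat \<Rightarrow> 'a" and k x y a
    assume "k \<in> {1..m}"
    show "contraction n {1..m} c (z(k := \<lambda>i. x i + y i))
          = contraction n {1..m} c (z(k := x)) + contraction n {1..m} c (z(k := y))
        \<and> contraction n {1..m} c (z(k := \<lambda>i. a * x i)) = a * contraction n {1..m} c (z(k := x))"
      unfolding split[OF \<open>k \<in> {1..m}\<close>]
      by (simp add: distrib_right sum.distrib sum_distrib_left mult.assoc)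
  qed
qed

lemma sign_type_contraction:
  assumes "\<And>i. c i \<in> {-1, 1}"
  shows "sign_type m n (contraction n {1..m} c)"
  unfolding sign_type_def contraction_def
proof (intro exI[of _ "\<lambda>i. of_real (c i)"] conjI ballI refl)
  show "of_real (c i) \<in> {-1, 1}" for i
    using assms[of i] by auto
qed

text \<open>Squares appear because the chain bound and the Cauchy-Schwarz inequality control squared
  norms.\<close>

lemma form_norm_le:
  fixes A :: "(nat \<Rightarrow> nat \<Rightarrow> 'a::real_normed_field) \<Rightarrow> 'a"
  assumes "B \<ge> 0"
    and "\<And>z. \<forall>k\<in>{1..m}. lp_norm (p k) (n k) (z k) \<le> 1 \<Longrightarrow> (norm (A z))\<^sup>2 \<le> B\<^sup>2"
  shows "form_norm m p n A \<le> ereal B"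
  unfolding form_norm_def
proof (rule SUP_least)
  fix z :: "nat \<Rightarrow> nat \<Rightarrow> 'a" assume "z \<in> {z \<in> tuples m n. \<forall>k\<in>{1..m}. lp_norm (p k) (n k) (z k) \<le> 1}"
  then have "(norm (A z))\<^sup>2 \<le> B\<^sup>2"
    using assms(2) by blast
  then show "ereal (norm (A z)) \<le> ereal B"
    using assms(1) power2_le_imp_le by simp
qed

section \<open>Construction of the form and choice of constants\<close>

lemma contraction_singleton:
  "contraction n {r} (\<lambda>i. 1) z = (\<Sum>i=1..n r. z r i)"
  by (subst contraction_insert) (auto simp: contraction_def)

text \<open>The chain through slot 1 and the inner slots, with output width \<open>n m\<close>,
  yields a vector that is paired with \<open>z m\<close> by the Cauchy-Schwarz inequality.\<close>

lemma ex_sign_form: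
  fixes n :: "nat \<Rightarrow> nat" and p :: "nat \<Rightarrow> ereal" and C :: real
  assumes m: "m \<ge> 1" and p1: "p 1 \<in> {2..\<infinity>}" and pm: "p m \<in> {2..\<infinity>}"
    and mid: "\<forall>k\<in>{1<..<m}. p k = \<infinity>"
    and good: "sign_bounded C N TYPE('a::{real_normed_field, real_inner})" and C: "C \<ge> 1" "C ^ m \<le> D\<^sup>2" "D \<ge> 0"
    and nN: "\<forall>k\<in>{1..m}. n k > N"
    and nm: "\<forall>k\<in>{1..m}. n k \<le> n m" and n1: "\<forall>k\<in>{1..m}. n 1 \<le> n k"
  shows "\<exists>A :: (nat \<Rightarrow> nat \<Rightarrow> 'a) \<Rightarrow> 'a. multilinear_form m n A \<and> sign_type m n A \<and>
       form_norm m p n A \<le> ereal (D * real (n m) powr (1 / 2) *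
                       (\<Prod>k=1..m. real (n k) powr (1 / 2 - real_of_ereal (1 / p k))))"
proof -
  define e where "e k = real (n k) powr (1 / 2 - real_of_ereal (1 / p k))" for k
  define B where "B = D * real (n m) powr (1 / 2) * (\<Prod>k=1..m. e k)"
  have B0: "B \<ge> 0"
    using C by (auto simp: B_def e_def intro!: mult_nonneg_nonneg prod_nonneg)
  have half: "(real k powr (1 / 2))\<^sup>2 = real k" for k
    by (simp add: powr_half_sqrt)
  have pos: "n k > 0" if "k \<in> {1..m}" for k
    using nN that by force
  have B2: "B\<^sup>2 = D\<^sup>2 * real (n m) * (\<Prod>k=1..m. (e k)\<^sup>2)"
    unfolding B_def by (simp only: power_mult_distrib half prod_power_distrib)
  have D: "1 \<le> D\<^sup>2"
    using C one_le_power[of C m] by linarith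
  have "\<exists>c. (\<forall>i. c i \<in> {-1, 1}) \<and> (\<forall>z :: nat \<Rightarrow> nat \<Rightarrow> 'a.
      (\<forall>k\<in>{1..m}. lp_norm (p k) (n k) (z k) \<le> 1) \<longrightarrow> (norm (contraction n {1..m} c z))\<^sup>2 \<le> B\<^sup>2)"
  proof (cases "m = 1")
    case True
    \<comment> \<open>Slots 1 and \<open>m\<close> coincide, so there is no chain. All signs are 1,
      and the factor \<open>n m\<close> in the squared bound is the squared norm of the all-ones
      vector.\<close>
    show ?thesis
    proof (intro exI[of _ "\<lambda>i. 1"] conjI allI impI)
      fix z :: "nat \<Rightarrow> nat \<Rightarrow> 'a"
      assume z: "\<forall>k\<in>{1..m}. lp_norm (p k) (n k) (z k) \<le> 1"
      have l2: "(\<Sum>i=1..n 1. (norm (z 1 i))\<^sup>2) \<le> (e 1)\<^sup>2"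
        unfolding e_def using p1 pos z True by (intro l2_le_if_lp_norm_le_1) auto
      have "contraction n {1..m} (\<lambda>i. 1) z = (\<Sum>i=1..n 1. 1 * z 1 i)"
        using contraction_singleton[of n 1 z] True by simp
      then have "(norm (contraction n {1..m} (\<lambda>i. 1) z))\<^sup>2
          \<le> (\<Sum>i=1..n 1. (norm (1 :: 'a))\<^sup>2) * (\<Sum>i=1..n 1. (norm (z 1 i))\<^sup>2)"
        by (simp only: norm_sum_mult_le)
      also have "\<dots> = 1 * real (n m) * (\<Sum>i=1..n 1. (norm (z 1 i))\<^sup>2)"
        using True by simp
      also have "\<dots> \<le> D\<^sup>2 * real (n m) * (e 1)\<^sup>2"
        using D l2 by (intro mult_mono sum_nonneg) auto
      also have "\<dots> = B\<^sup>2"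
        using True by (simp add: B2)
      finally show "(norm (contraction n {1..m} (\<lambda>i. 1) z))\<^sup>2 \<le> B\<^sup>2" .
    qed auto
  next
    case False
    define S where "S = {1<..<m}"
    have S: "finite S" "1 \<notin> S" "m \<notin> insert 1 S" "insert m (insert 1 S) = {1..m}" "card S = m - 2"
      using m False by (auto simp: S_def)
    have C0: "C \<ge> 0"
      using C by simp
    have n: "N < n 1" "\<forall>k\<in>S. n 1 \<le> n k" "\<forall>k\<in>insert 1 S. n k \<le> n m"
      using nN n1 nm m by (auto simp: S_def)
    obtain c :: "(nat \<Rightarrow> nat) \<Rightarrow> nat \<Rightarrow> real" where c: "\<And>i j. c i j \<in> {-1, 1}"
      and cb: "\<And>z :: nat \<Rightarrow> nat \<Rightarrow> 'a. (\<forall>k\<in>S. \<forall>i\<in>{1..n k}. norm (z k i) \<le> 1) \<Longrightarrow>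
          (\<Sum>j=1..n m. (norm (contraction n (insert 1 S) (\<lambda>i. c i j) z))\<^sup>2)
            \<le> C ^ Suc (card S) * real (n m) * (\<Prod>k\<in>S. real (n k)) * (\<Sum>i=1..n 1. (norm (z 1 i))\<^sup>2)"
      using chain_bound[OF good C0 S(1,2) n(1,2), THEN spec, THEN mp, OF n(3)] by blast
    \<comment> \<open>The factor 1 gives the shape of \<open>contraction_insert_product\<close> with
      an all-ones column.\<close>
    define d where "d i = c (restrict i (insert 1 S)) (i m) * 1" for i
    \<comment> \<open>The chain uses \<open>m - 1\<close> matrices, one for each slot except the
      last.\<close>
    have "C ^ Suc (card S) \<le> C ^ m"
      using C(1) m False S by (intro power_increasing) auto
    then have CD: "C ^ Suc (card S) \<le> D\<^sup>2"
      using C by simp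
    have eS: "(e k)\<^sup>2 = real (n k)" if "k \<in> S" for k
      using mid that by (simp add: S_def e_def half)
    have "(\<Prod>k=1..m. (e k)\<^sup>2) = (e m)\<^sup>2 * ((e 1)\<^sup>2 * (\<Prod>k\<in>S. real (n k)))"
      using S(1-3) eS unfolding S(4)[symmetric] by simp
    then have B2': "B\<^sup>2 = D\<^sup>2 * real (n m) * (\<Prod>k\<in>S. real (n k)) * (e 1)\<^sup>2 * (e m)\<^sup>2"
      by (simp add: B2 mult_ac)
    show ?thesis
    proof (intro exI[of _ d] conjI allI impI)
      show "d i \<in> {-1, 1}" for i
        using c by (simp add: d_def)
      fix z :: "nat \<Rightarrow> nat \<Rightarrow> 'a"
      assume z: "\<forall>k\<in>{1..m}. lp_norm (p k) (n k) (z k) \<le> 1"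
      let ?v = "\<lambda>a. contraction n (insert 1 S) (\<lambda>i. c i a) z"
      have l1: "(\<Sum>i=1..n 1. (norm (z 1 i))\<^sup>2) \<le> (e 1)\<^sup>2"
        unfolding e_def using p1 pos z m by (intro l2_le_if_lp_norm_le_1) auto
      have lm: "(\<Sum>i=1..n m. (norm (z m i))\<^sup>2) \<le> (e m)\<^sup>2"
        unfolding e_def using pm pos z m by (intro l2_le_if_lp_norm_le_1) auto
      have "\<forall>k\<in>S. \<forall>i\<in>{1..n k}. norm (z k i) \<le> 1"
      proof (intro ballI)
        fix k i assume k: "k \<in> S" "i \<in> {1..n k}"
        then have "p k = \<infinity>" "k \<in> {1..m}"
          using mid by (auto simp: S_def)
        then have "lp_norm \<infinity> (n k) (z k) \<le> 1"
          using z by metis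
        then show "norm (z k i) \<le> 1"
          using k(2) by (rule norm_le_1_if_lp_norm_infinity_le_1)
      qed
      note v = cb[OF this]
      have "contraction n {1..m} d z = (\<Sum>a=1..n m. z m a * ?v a)"
        using contraction_insert_product[OF _ S(3), of n c "\<lambda>a. 1" z] S(1)
        unfolding S(4) d_def by simp
      then have "(norm (contraction n {1..m} d z))\<^sup>2
          \<le> (\<Sum>a=1..n m. (norm (z m a))\<^sup>2) * (\<Sum>a=1..n m. (norm (?v a))\<^sup>2)"
        by (simp only: norm_sum_mult_le)
      also have "\<dots> \<le> (e m)\<^sup>2 *
          (C ^ Suc (card S) * real (n m) * (\<Prod>k\<in>S. real (n k)) * (\<Sum>i=1..n 1. (norm (z 1 i))\<^sup>2))"
        using lm v by (intro mult_mono sum_nonneg) auto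
      also have "\<dots> \<le> (e m)\<^sup>2 * (D\<^sup>2 * real (n m) * (\<Prod>k\<in>S. real (n k)) * (e 1)\<^sup>2)"
        using CD l1 C0 by (intro mult_left_mono mult_mono sum_nonneg mult_nonneg_nonneg prod_nonneg) auto
      also have "\<dots> = B\<^sup>2"
        by (simp add: B2' mult_ac)
      finally show "(norm (contraction n {1..m} d z))\<^sup>2 \<le> B\<^sup>2" .
    qed
  qed
  then obtain c where c: "\<And>i. c i \<in> {-1, 1}" and cb: "\<And>z :: nat \<Rightarrow> nat \<Rightarrow> 'a.
      \<forall>k\<in>{1..m}. lp_norm (p k) (n k) (z k) \<le> 1 \<Longrightarrow> (norm (contraction n {1..m} c z))\<^sup>2 \<le> B\<^sup>2"
    by blast
  let ?A = "contraction n {1..m} c :: (nat \<Rightarrow> nat \<Rightarrow> 'a) \<Rightarrow> 'a"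
  show ?thesis
  proof (intro exI[of _ ?A] conjI)
    show "multilinear_form m n ?A"
      by (rule multilinear_form_contraction)
    show "sign_type m n ?A"
      using c by (rule sign_type_contraction)
    have "form_norm m p n ?A \<le> ereal B"
      by (rule form_norm_le[OF B0]) (rule cb)
    then show "form_norm m p n ?A \<le> ereal (D * real (n m) powr (1 / 2) *
        (\<Prod>k=1..m. real (n k) powr (1 / 2 - real_of_ereal (1 / p k))))"
      unfolding B_def e_def .
  qed
qed

lemma ex_sign_form_of_large_dimensions:
  fixes m :: nat and p :: "nat \<Rightarrow> ereal" and \<epsilon> :: real
  assumes "m \<ge> 1"
    and "p 1 \<in> {2..\<infinity>}" and "p m \<in> {2..\<infinity>}"
    and "\<forall>k\<in>{1<..<m}. p k = \<infinity>"
    and "\<epsilon> > 0"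
  shows "\<exists>N::nat. N > 0 \<and>
           (\<forall>n :: nat \<Rightarrow> nat.
              (\<forall>k\<in>{1..m}. n k > N) \<and>
              n m = Max (n ` {1..m}) \<and> n 1 = Min (n ` {1..m}) \<longrightarrow>
              (\<exists>A :: (nat \<Rightarrow> nat \<Rightarrow> 'a::{real_normed_field, real_inner}) \<Rightarrow> 'a.
                 multilinear_form m n A \<and> sign_type m n A \<and>
                 form_norm m p n A
                   \<le> ereal ((1 + \<epsilon>) * real (n m) powr (1 / 2) *
                       (\<Prod>k=1..m. real (n k) powr (1 / 2 - real_of_ereal (1 / p k))))))"
proof -
  \<comment> \<open>The squared norm may lose a factor \<open>(1 + \<epsilon>)\<^sup>2\<close>; the
    matrices lose at most \<open>C ^ m = 1 + \<epsilon>\<close>.\<close>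
  define C where "C = root m (1 + \<epsilon>)"
  have C: "C > 1" "C ^ m = 1 + \<epsilon>"
    using assms(1,5) by (auto simp: C_def)
  have C2: "C ^ m \<le> (1 + \<epsilon>)\<^sup>2"
    using assms(5) by (simp add: C(2) power2_eq_square)
  obtain N where N: "sign_bounded C N TYPE('a)"
    using ex_sign_bounded[OF C(1)] by blast
  \<comment> \<open>The witness \<open>Suc N\<close> is positive, also when \<open>N\<close> is
    0.\<close>
  show ?thesis
  proof (intro exI[of _ "Suc N"] conjI allI impI)
    fix n :: "nat \<Rightarrow> nat"
    assume n: "(\<forall>k\<in>{1..m}. n k > Suc N) \<and> n m = Max (n ` {1..m}) \<and> n 1 = Min (n ` {1..m})"
    show "\<exists>A :: (nat \<Rightarrow> nat \<Rightarrow> 'a) \<Rightarrow> 'a.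
                 multilinear_form m n A \<and> sign_type m n A \<and>
                 form_norm m p n A
                   \<le> ereal ((1 + \<epsilon>) * real (n m) powr (1 / 2) *
                       (\<Prod>k=1..m. real (n k) powr (1 / 2 - real_of_ereal (1 / p k))))"
    proof (rule ex_sign_form[OF assms(1-4) N _ C2])
      show "\<forall>k\<in>{1..m}. n k > N"
        using n Suc_lessD by blast
      show "\<forall>k\<in>{1..m}. n k \<le> n m" "\<forall>k\<in>{1..m}. n 1 \<le> n k"
        using n by auto
    qed (use C assms(5) in auto)
  qed simp
qed

theorem theorem4p1:
  fixes m :: nat and p :: "nat \<Rightarrow> ereal" and \<epsilon> :: real
  assumes "m \<ge> 1"
    and "p 1 \<in> {2..\<infinity>}" and "p m \<in> {2..\<infinity>}"
    and "\<forall>k\<in>{1<..<m}. p k = \<infinity>"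
    and "\<epsilon> > 0"
  shows "(\<exists>N::nat. N > 0 \<and>
           (\<forall>n :: nat \<Rightarrow> nat.
              (\<forall>k\<in>{1..m}. n k > N) \<and>
              n m = Max (n ` {1..m}) \<and> n 1 = Min (n ` {1..m}) \<longrightarrow>
              (\<exists>A :: (nat \<Rightarrow> nat \<Rightarrow> real) \<Rightarrow> real.
                 multilinear_form m n A \<and> sign_type m n A \<and>
                 form_norm m p n A
                   \<le> ereal ((1 + \<epsilon>) * real (n m) powr (1 / 2) *
                       (\<Prod>k=1..m. real (n k) powr (1 / 2 - real_of_ereal (1 / p k)))))))
       \<and> (\<exists>N::nat. N > 0 \<and>
           (\<forall>n :: nat \<Rightarrow> nat.
              (\<forall>k\<in>{1..m}. n k > N) \<and>
              n m = Max (n ` {1..m}) \<and> n 1 = Min (n ` {1..m}) \<longrightarrow>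
              (\<exists>A :: (nat \<Rightarrow> nat \<Rightarrow> complex) \<Rightarrow> complex.
                 multilinear_form m n A \<and> sign_type m n A \<and>
                 form_norm m p n A
                   \<le> ereal ((1 + \<epsilon>) * real (n m) powr (1 / 2) *
                       (\<Prod>k=1..m. real (n k) powr (1 / 2 - real_of_ereal (1 / p k)))))))"
  by (rule conjI; rule ex_sign_form_of_large_dimensions[OF assms])

end
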